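(* Let $(X,V,W,S,\mathcal H_*,h,*,\Theta)$ satisfy the abstract symmetrization framework described in the context. Let $(X,\|\cdot\|_V)$ be a Banach space, let $F:(X,\|\cdot\|_V)\to(X,\|\cdot\|_V)$ be continuous and assume that there exists $0<\sigma<1$ such that $$\forall u\in X\ \ \exists t\in(0,1]:\qquad \|F(tF(u)+(1-t)u)-F(u)\|_V\le\sigma t\,\|F(u)-u\|_V .$$ Assume that $F(S)\subset S$, that $F(u^H)=F(u)^H$ for all $H\in\mathcal H_*$ and $u\in S$, and that for every $u\in X$ there exists $\xi\in S$ such that $\|\xi-F(\xi)\|_V\le\|u-F(u)\|_V$. Then, for any $\varepsilon\in(0,1-\sigma)$ there exists a fixed point $\xi_\varepsilon\in X$ of $F$ such that $\|\xi_\varepsilon-\xi_\varepsilon^*\|_V<\varepsilon$.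
   Context: Abstract framework. $X,V,W$ are real Banach spaces with $X\subseteq V\subseteq W$, $X$ continuously embedded in $V$ and $V$ continuously embedded in $W$; $\|\cdot\|$ is the norm of $X$. $S\subseteq X$ carries the metric induced by $\|\cdot\|$, $\mathcal H_*$ is a path-connected topological space, and there are maps $*:S\to S$, $u\mapsto u^*$ (symmetrization) and $h:S\times\mathcal H_*\to S$, $(u,H)\mapsto u^H$ (polarization) such that: $h$ is continuous; $(u^* )^H=(u^H)^*=u^*$ and $(u^H)^H=u^H$ for all $u\in S$, $H\in\mathcal H_*$; there is a sequence $(H_m)\subset\mathcal H_*$ such that for every $u\in S$ the iterated polarizations $u^{H_1\cdots H_m}$ converge to $u^*$ in $V$ as $m\to\infty$; $\|u^H-v^H\|_V\le\|u-v\|_V$ for all $u,v\in S$, $H\in\mathcal H_*$. Moreover $\Theta:(X,\|\cdot\|_V)\to(S,\|\cdot\|_V)$ is Lipschitz with constant $C_\Theta>0$ and $\Theta|_S=\mathrm{Id}|_S$; for $u\in X$ one sets $u^H:=(\Theta(u))^H$ and $u^*:=(\Theta(u))^*$. *)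

theory Defs
  imports "HOL-Analysis.Analysis"
begin

text \<open>
  The inclusions of X into V and of V into W are rendered as injective bounded linear maps
  between Banach space types; for \<open>u\<close> in X, the V-norm of \<open>u\<close> is \<open>norm (\<iota> u)\<close>.
\<close>

definition V_dist :: "('x::real_vector \<Rightarrow> 'v::real_normed_vector) \<Rightarrow> 'x \<Rightarrow> 'x \<Rightarrow> real" where
  "V_dist \<iota> u v = norm (\<iota> (u - v))"

text \<open>\<open>iter_pol pol Hs u m\<close> is \<open>u\<close> polarized first by \<open>Hs 1\<close>, then \<open>Hs 2\<close>, up to \<open>Hs m\<close>;
  the sequence is indexed from 1, so \<open>Hs 0\<close> is not used.\<close>

primrec iter_pol :: "('x \<Rightarrow> 'h \<Rightarrow> 'x) \<Rightarrow> (nat \<Rightarrow> 'h) \<Rightarrow> 'x \<Rightarrow> nat \<Rightarrow> 'x" where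
  "iter_pol pol Hs u 0 = u"
| "iter_pol pol Hs u (Suc m) = pol (iter_pol pol Hs u m) (Hs (Suc m))"

text \<open>
  The path-connected space of polarizers is the whole type \<open>'h\<close>. The maps \<open>pol\<close> and \<open>star\<close> are
  meaningful on \<open>S\<close> only; on all of X, polarization and symmetrization are
  \<open>pol (\<Theta> u) H\<close> and \<open>star (\<Theta> u)\<close>.
\<close>

locale symmetrization_framework =
  fixes \<iota> :: "'x::banach \<Rightarrow> 'v::banach"
    and \<kappa> :: "'v \<Rightarrow> 'w::banach"
    and S :: "'x set"
    and pol :: "'x \<Rightarrow> 'h::topological_space \<Rightarrow> 'x"
    and star :: "'x \<Rightarrow> 'x"
    and \<Theta> :: "'x \<Rightarrow> 'x"
  assumes embed_XV: "bounded_linear \<iota>" "inj \<iota>"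
    and embed_VW: "bounded_linear \<kappa>" "inj \<kappa>"
    and path_connected_polarizers: "path_connected (UNIV :: 'h set)"
    and star_in: "\<And>u. u \<in> S \<Longrightarrow> star u \<in> S"
    and pol_in: "\<And>u H. u \<in> S \<Longrightarrow> pol u H \<in> S"
    and pol_continuous: "continuous_on (S \<times> UNIV) (\<lambda>(u, H). pol u H)"
    and pol_star: "\<And>u H. u \<in> S \<Longrightarrow> pol (star u) H = star u"
    and star_pol: "\<And>u H. u \<in> S \<Longrightarrow> star (pol u H) = star u"
    and pol_pol: "\<And>u H. u \<in> S \<Longrightarrow> pol (pol u H) H = pol u H"
    and iter_pol_tendsto:
      "\<exists>Hs. \<forall>u\<in>S. (\<lambda>m. \<iota> (iter_pol pol Hs u m)) \<longlonglongrightarrow> \<iota> (star u)"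
    and pol_nonexpansive:
      "\<And>u v H. u \<in> S \<Longrightarrow> v \<in> S \<Longrightarrow> norm (\<iota> (pol u H - pol v H)) \<le> norm (\<iota> (u - v))"
    and Theta_in: "\<And>u. \<Theta> u \<in> S"
    and Theta_lipschitz:
      "\<exists>C>0. \<forall>u v. norm (\<iota> (\<Theta> u - \<Theta> v)) \<le> C * norm (\<iota> (u - v))"
    and Theta_id: "\<And>u. u \<in> S \<Longrightarrow> \<Theta> u = u"

lemma Metric_space_V_dist:
  assumes "linear \<iota>" and "inj \<iota>"
  shows "Metric_space UNIV (V_dist \<iota>)"
proof
  interpret linear \<iota> by fact
  fix x y z
  show "0 \<le> V_dist \<iota> x y" by (simp add: V_dist_def)
  show "V_dist \<iota> x y = V_dist \<iota> y x" by (simp add: V_dist_def diff norm_minus_commute)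
  show "V_dist \<iota> x y = 0 \<longleftrightarrow> x = y"
    using assms(2) by (simp add: V_dist_def diff inj_eq)
  show "V_dist \<iota> x z \<le> V_dist \<iota> x y + V_dist \<iota> y z"
    using norm_triangle_ineq[of "\<iota> x - \<iota> y" "\<iota> y - \<iota> z"] by (simp add: V_dist_def diff)
qed

end

theory Submission imports Defs begin

text \<open>
  By the contraction-type hypothesis, each \<open>u\<close> has a point \<open>v\<close> on the segment to \<open>F u\<close> with
  \<open>\<parallel>F v - v\<parallel> \<le> \<parallel>F u - u\<parallel> - (1 - \<sigma>) \<parallel>v - u\<parallel>\<close> in the V-norm, where \<open>v \<noteq> u\<close> unless \<open>F u = u\<close>.
  So a point at which the displacement of \<open>F\<close> is minimal in the sense of Ekeland is a fixed
  point. The domination hypothesis then moves the fixed point into \<open>S\<close>, where its iterated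
  polarizations are again fixed points, have the same symmetrization, and converge to it in V.
\<close>

text \<open>Ekeland's variational principle with constant 1. Descend along a sequence that at each
  step covers at least half of the possible drop of \<open>f\<close>. Distances are bounded by drops
  of \<open>f\<close>, so completeness gives a limit, and no other point lies below that
  limit.\<close>

lemma (in Metric_space) ekeland_minimal_point:
  fixes f :: "'a \<Rightarrow> real"
  assumes complete: mcomplete and nonempty: "M \<noteq> {}"
    and bdd: "bdd_below (f ` M)"
    and lsc: "\<And>a. closedin mtopology {x \<in> M. f x \<le> a}"
  obtains x where "x \<in> M" and "\<And>y. y \<in> M \<Longrightarrow> f y + d x y \<le> f x \<Longrightarrow> y = x"
proof -
  \<comment> \<open>\<open>T x\<close> is the set of points below \<open>x\<close> in the Ekeland
    order; the triangle inequality makes this order transitive. The aim is a point with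
    \<open>T x = {x}\<close>.\<close>
  define T where "T x = {y \<in> M. f y + d x y \<le> f x}" for x
  have T_self: "x \<in> T x" if "x \<in> M" for x
    using that by (simp add: T_def)
  have T_trans: "z \<in> T x" if "x \<in> M" "y \<in> T x" "z \<in> T y" for x y z
    using that triangle[of x y z] by (auto simp: T_def)
  have bdd_T: "bdd_below (f ` T x)" for x
    by (rule bdd_below_mono[OF bdd]) (auto simp: T_def)
  \<comment> \<open>The midpoint between \<open>f x\<close> and the infimum lies strictly above the
    infimum unless \<open>f x\<close> already attains it; in that case \<open>x\<close> itself
    serves.\<close>
  have halving: "\<exists>y\<in>T x. f y \<le> (f x + Inf (f ` T x)) / 2" if "x \<in> M" for x
  proof (cases "Inf (f ` T x) < f x")
    case True
    then have "Inf (f ` T x) < (f x + Inf (f ` T x)) / 2" by simp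
    moreover have "f ` T x \<noteq> {}" using T_self[OF that] by blast
    ultimately have "\<exists>z\<in>f ` T x. z < (f x + Inf (f ` T x)) / 2"
      by (intro cInf_lessD)
    then show ?thesis by (auto intro: less_imp_le)
  next
    case False
    then have "f x \<le> (f x + Inf (f ` T x)) / 2" by simp
    then show ?thesis using T_self[OF that] by (rule bexI)
  qed
  obtain s where s_M: "\<And>n. s n \<in> M" and s_T: "\<And>n. s (Suc n) \<in> T (s n)"
    and s_half: "\<And>n. f (s (Suc n)) \<le> (f (s n) + Inf (f ` T (s n))) / 2"
  proof -
    have "\<exists>s. \<forall>n. s n \<in> M \<and>
      (s (Suc n) \<in> T (s n) \<and> f (s (Suc n)) \<le> (f (s n) + Inf (f ` T (s n))) / 2)"
    proof (rule dependent_nat_choice)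
      show "\<exists>x. x \<in> M" using nonempty by blast
    next
      fix x assume "x \<in> M"
      from halving[OF this] obtain y where "y \<in> T x" "f y \<le> (f x + Inf (f ` T x)) / 2" ..
      moreover from this have "y \<in> M" by (simp add: T_def)
      ultimately show "\<exists>y. y \<in> M \<and> (y \<in> T x \<and> f y \<le> (f x + Inf (f ` T x)) / 2)"
        by blast
    qed
    then show thesis using that by blast
  qed
  have T_mono: "s m \<in> T (s n)" if "n \<le> m" for n m
    using that
  proof (induction m rule: dec_induct)
    case base
    show ?case by (rule T_self[OF s_M])
  next
    case (step m)
    then show ?case using T_trans[OF s_M _ s_T] by blast
  qed
  \<comment> \<open>This turns convergence of the decreasing values \<open>f (s n)\<close> into the
    Cauchy property of \<open>s\<close>.\<close>
  have dist_le: "d (s n) (s m) \<le> f (s n) - f (s m)" if "n \<le> m" for n m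
    using T_mono[OF that] by (simp add: T_def)
  have f_dec: "f (s m) \<le> f (s n)" if "n \<le> m" for n m
    using dist_le[OF that] nonneg[of "s n" "s m"] by linarith
  then have "decseq (f \<circ> s)"
    by (simp add: decseq_def)
  moreover have "bdd_below (range (f \<circ> s))"
    by (rule bdd_below_mono[OF bdd]) (use s_M in auto)
  ultimately have fs_lim: "(f \<circ> s) \<longlonglongrightarrow> (INF n. (f \<circ> s) n)"
    by (rule LIMSEQ_decseq_INF[rotated])
  have "MCauchy s"
    unfolding MCauchy_def
  proof (intro conjI strip)
    show "range s \<subseteq> M" using s_M by blast
    fix e :: real assume "e > 0"
    have "Cauchy (f \<circ> s)" using fs_lim by (rule LIMSEQ_imp_Cauchy)
    then obtain N where N: "\<And>m n. m \<ge> N \<Longrightarrow> n \<ge> N \<Longrightarrow> \<bar>f (s m) - f (s n)\<bar> < e"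
      using CauchyD[OF _ \<open>e > 0\<close>] by (force simp: o_def)
    have "d (s n) (s m) < e" if "N \<le> n" "N \<le> m" for n m
    proof (cases "n \<le> m")
      case True then show ?thesis using dist_le[of n m] N[OF that] by linarith
    next
      case False
      then show ?thesis using dist_le[of m n] N[OF that] commute[of "s n" "s m"] by linarith
    qed
    then show "\<exists>N. \<forall>n n'. N \<le> n \<longrightarrow> N \<le> n' \<longrightarrow> d (s n) (s n') < e" by blast
  qed
  then obtain x where x_lim: "limitin mtopology s x sequentially"
    using complete by (auto simp: mcomplete_def)
  then have "x \<in> M" and d_lim: "(\<lambda>m. d (s m) x) \<longlonglongrightarrow> 0"
    by (auto simp: limitin_metric_dist_null)
  \<comment> \<open>The tail of \<open>s\<close> from index \<open>n\<close> on stays in the closed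
    sublevel set at height \<open>f (s n)\<close>, hence so does its limit.\<close>
  have f_le: "f x \<le> f (s n)" for n
  proof -
    have "x \<in> {x \<in> M. f x \<le> f (s n)}"
    proof (rule limitin_closedin[OF x_lim lsc])
      show "\<forall>\<^sub>F m in sequentially. s m \<in> {x \<in> M. f x \<le> f (s n)}"
        using eventually_ge_at_top[of n]
      proof eventually_elim
        case (elim m)
        then show ?case using f_dec s_M by simp
      qed
    qed simp
    then show ?thesis by blast
  qed
  \<comment> \<open>Go from \<open>s n\<close> to \<open>x\<close> through \<open>s m\<close>,
    replace \<open>f (s m)\<close> by the smaller \<open>f x\<close>, and let \<open>m\<close> tend
    to infinity.\<close>
  have x_T: "x \<in> T (s n)" for n
  proof -
    have "d (s n) x \<le> (f (s n) - f x) + d (s m) x" if "n \<le> m" for m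
      using triangle[OF s_M[of n] s_M[of m] \<open>x \<in> M\<close>] dist_le[OF that] f_le[of m] by linarith
    then have "\<forall>\<^sub>F m in sequentially. d (s n) x \<le> (f (s n) - f x) + d (s m) x"
      by (auto simp: eventually_sequentially)
    moreover have "(\<lambda>m. (f (s n) - f x) + d (s m) x) \<longlonglongrightarrow> (f (s n) - f x) + 0"
      by (intro tendsto_intros d_lim)
    ultimately have "d (s n) x \<le> (f (s n) - f x) + 0"
      by (intro tendsto_lowerbound) auto
    then show ?thesis using \<open>x \<in> M\<close> by (simp add: T_def)
  qed
  show thesis
  proof
    show "x \<in> M" by fact
    fix y assume "y \<in> M" and y: "f y + d x y \<le> f x"
    then have "y \<in> T (s n)" for n
      by (intro T_trans[OF s_M x_T]) (simp add: T_def)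
    then have Inf_le: "Inf (f ` T (s n)) \<le> f y" for n
      by (intro cInf_lower imageI bdd_T)
    \<comment> \<open>The halving bound solved for the infimum. Both \<open>f (s n)\<close> and
      \<open>f (s (Suc n))\<close> tend to the same limit \<open>L\<close>, so the left side tends
      to \<open>2 * L - L = L\<close>. Thus \<open>f x \<le> L \<le> f y\<close>, which leaves no
      room for a positive \<open>d x y\<close>.\<close>
    have "2 * f (s (Suc n)) - f (s n) \<le> f y" for n
      using s_half[of n] Inf_le[of n] by simp
    moreover have "(\<lambda>n. 2 * f (s (Suc n)) - f (s n)) \<longlonglongrightarrow>
        2 * (INF n. (f \<circ> s) n) - (INF n. (f \<circ> s) n)"
      using fs_lim by (intro tendsto_intros LIMSEQ_Suc) (simp_all add: o_def)
    ultimately have "(INF n. (f \<circ> s) n) \<le> f y"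
      using LIMSEQ_le_const2[of _ "2 * (INF n. (f \<circ> s) n) - (INF n. (f \<circ> s) n)" "f y"] by simp
    moreover have "f x \<le> (INF n. (f \<circ> s) n)"
      by (rule cINF_greatest) (use f_le in auto)
    ultimately have "d x y \<le> 0" using y by linarith
    then show "y = x"
      using \<open>x \<in> M\<close> \<open>y \<in> M\<close> nonneg[of x y] zero[of x y] by (metis order_antisym)
  qed
qed

text \<open>Write \<open>D\<close> for the displacement at \<open>u\<close>. The triangle inequality
  through \<open>F u\<close> bounds the displacement at \<open>v\<close> by \<open>\<sigma> * t * D
  + (1 - t) * D = D - (1 - \<sigma>) * (t * D)\<close>, and \<open>t * D\<close> is exactly the
  distance from \<open>u\<close> to \<open>v\<close>.\<close>

lemma displacement_relaxation_step:
  fixes \<iota> :: "'x::real_vector \<Rightarrow> 'v::real_normed_vector"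
  assumes "linear \<iota>" and "0 \<le> t" "t \<le> 1"
    and contr: "norm (\<iota> (F (t *\<^sub>R F u + (1 - t) *\<^sub>R u) - F u)) \<le> \<sigma> * t * norm (\<iota> (F u - u))"
  defines "v \<equiv> t *\<^sub>R F u + (1 - t) *\<^sub>R u"
  shows "V_dist \<iota> u v = t * V_dist \<iota> (F u) u"
    and "V_dist \<iota> (F v) v + (1 - \<sigma>) * V_dist \<iota> u v \<le> V_dist \<iota> (F u) u"
proof -
  interpret linear \<iota> by fact
  have "u - v = - t *\<^sub>R (F u - u)" and Fu_v: "F u - v = (1 - t) *\<^sub>R (F u - u)"
    by (simp_all add: v_def algebra_simps)
  then show dist: "V_dist \<iota> u v = t * V_dist \<iota> (F u) u"
    using assms(2) by (simp add: V_dist_def neg scaleR)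
  have "V_dist \<iota> (F v) v \<le> norm (\<iota> (F v - F u)) + norm (\<iota> (F u - v))"
    using norm_triangle_ineq[of "\<iota> (F v - F u)" "\<iota> (F u - v)"] by (simp add: V_dist_def diff)
  also have "norm (\<iota> (F u - v)) = (1 - t) * V_dist \<iota> (F u) u"
    using assms(3) by (simp add: Fu_v V_dist_def scaleR)
  also have "norm (\<iota> (F v - F u)) \<le> \<sigma> * t * V_dist \<iota> (F u) u"
    using contr by (simp only: v_def V_dist_def)
  finally have "V_dist \<iota> (F v) v \<le> \<sigma> * t * V_dist \<iota> (F u) u + (1 - t) * V_dist \<iota> (F u) u"
    by simp
  then show "V_dist \<iota> (F v) v + (1 - \<sigma>) * V_dist \<iota> u v \<le> V_dist \<iota> (F u) u"
    unfolding dist by (simp add: algebra_simps)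
qed

text \<open>At an Ekeland-minimal point of the rescaled displacement, the relaxation step cannot
  move, which forces the displacement to vanish.\<close>

lemma fixed_point_of_relaxed_contraction:
  fixes \<iota> :: "'x::real_vector \<Rightarrow> 'v::real_normed_vector"
  assumes lin: "linear \<iota>" and inj: "inj \<iota>"
    and complete: "Metric_space.mcomplete (UNIV :: 'x set) (V_dist \<iota>)"
    and cont: "continuous_map (Metric_space.mtopology UNIV (V_dist \<iota>))
                 (Metric_space.mtopology UNIV (V_dist \<iota>)) F"
    and "\<sigma> < 1"
    and contr: "\<forall>u. \<exists>t. 0 < t \<and> t \<le> 1 \<and>
          norm (\<iota> (F (t *\<^sub>R F u + (1 - t) *\<^sub>R u) - F u)) \<le> \<sigma> * t * norm (\<iota> (F u - u))"
  shows "\<exists>u. F u = u"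
proof -
  interpret V: Metric_space UNIV "V_dist \<iota>"
    using lin inj by (rule Metric_space_V_dist)
  \<comment> \<open>Dividing by \<open>1 - \<sigma>\<close> normalizes the decrease in the
    relaxation step to the constant 1 of the variational principle.\<close>
  define f where "f u = V_dist \<iota> (F u) u / (1 - \<sigma>)" for u
  have "continuous_map V.mtopology euclideanreal (\<lambda>u. V_dist \<iota> (F u) u)"
    using continuous_map_mdist[of V.mtopology V.Self F "\<lambda>u. u"] cont
    by (simp add: V.Self_def)
  then have "closedin V.mtopology {u \<in> UNIV. V_dist \<iota> (F u) u \<le> a * (1 - \<sigma>)}" for a
    by (simp add: continuous_map_upper_lower_semicontinuous_le)
  then have lsc: "closedin V.mtopology {u \<in> UNIV. f u \<le> a}" for a
    using \<open>\<sigma> < 1\<close> by (simp add: f_def pos_divide_le_eq)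
  have bdd: "bdd_below (f ` UNIV)"
    using \<open>\<sigma> < 1\<close> by (intro bdd_belowI[of _ 0]) (auto simp: f_def V_dist_def)
  obtain u where min: "\<And>v. f v + V_dist \<iota> u v \<le> f u \<Longrightarrow> v = u"
    using V.ekeland_minimal_point[OF complete UNIV_not_empty bdd lsc] by auto
  obtain t where t: "0 < t" "t \<le> 1"
    and contr_u: "norm (\<iota> (F (t *\<^sub>R F u + (1 - t) *\<^sub>R u) - F u)) \<le> \<sigma> * t * norm (\<iota> (F u - u))"
    using contr by blast
  define v where "v = t *\<^sub>R F u + (1 - t) *\<^sub>R u"
  note step = displacement_relaxation_step[OF lin less_imp_le[OF t(1)] t(2) contr_u, folded v_def]
  have "f v + V_dist \<iota> u v \<le> f u"
    using divide_right_mono[OF step(2), of "1 - \<sigma>"] \<open>\<sigma> < 1\<close>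
    by (simp add: f_def add_divide_distrib)
  then have "v = u" by (rule min)
  \<comment> \<open>The step has length \<open>t\<close> times the displacement, and
    \<open>t\<close> is positive.\<close>
  then have "V_dist \<iota> (F u) u = 0" using step(1) t(1) by simp
  then show ?thesis by auto
qed

lemma (in symmetrization_framework) iter_pol_in:
  assumes "u \<in> S" shows "iter_pol pol Hs u m \<in> S"
  by (induction m) (simp_all add: assms pol_in)

lemma (in symmetrization_framework) star_iter_pol:
  assumes "u \<in> S" shows "star (iter_pol pol Hs u m) = star u"
  by (induction m) (simp_all add: assms star_pol iter_pol_in)

lemma (in symmetrization_framework) fixed_point_iter_pol:
  assumes "u \<in> S" "F u = u" and "\<forall>u\<in>S. \<forall>H. F (pol u H) = pol (F u) H"
  shows "F (iter_pol pol Hs u m) = iter_pol pol Hs u m"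
  by (induction m) (simp_all add: assms iter_pol_in)

theorem theorem3p7:
  fixes \<iota> :: "'x::banach \<Rightarrow> 'v::banach"
    and \<kappa> :: "'v \<Rightarrow> 'w::banach"
    and S :: "'x set"
    and pol :: "'x \<Rightarrow> 'h::topological_space \<Rightarrow> 'x"
    and star \<Theta> F :: "'x \<Rightarrow> 'x"
    and \<sigma> \<epsilon> :: real
  assumes framework: "symmetrization_framework \<iota> \<kappa> S pol star \<Theta>"
    and V_complete: "Metric_space.mcomplete (UNIV :: 'x set) (V_dist \<iota>)"
    and F_cont: "continuous_map (Metric_space.mtopology UNIV (V_dist \<iota>))
                   (Metric_space.mtopology UNIV (V_dist \<iota>)) F"
    and sigma: "0 < \<sigma>" "\<sigma> < 1"
    and F_contr: "\<forall>u. \<exists>t. 0 < t \<and> t \<le> 1 \<and>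
          norm (\<iota> (F (t *\<^sub>R F u + (1 - t) *\<^sub>R u) - F u)) \<le> \<sigma> * t * norm (\<iota> (F u - u))"
    and F_S: "F ` S \<subseteq> S"
    and F_pol: "\<forall>u\<in>S. \<forall>H. F (pol u H) = pol (F u) H"
    and F_dom: "\<forall>u. \<exists>\<xi>\<in>S. norm (\<iota> (\<xi> - F \<xi>)) \<le> norm (\<iota> (u - F u))"
    and eps: "0 < \<epsilon>" "\<epsilon> < 1 - \<sigma>"
  shows "\<exists>\<xi>. F \<xi> = \<xi> \<and> norm (\<iota> (\<xi> - star (\<Theta> \<xi>))) < \<epsilon>"
proof -
  interpret symmetrization_framework \<iota> \<kappa> S pol star \<Theta> by (fact framework)
  interpret \<iota>: bounded_linear \<iota> by (fact embed_XV)
  obtain u where "F u = u"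
    using fixed_point_of_relaxed_contraction[OF \<iota>.linear_axioms embed_XV(2) V_complete F_cont
        sigma(2) F_contr] by blast
  \<comment> \<open>Domination is applied at a fixed point: the right side is zero, so the
    dominating point of \<open>S\<close> is fixed as well.\<close>
  then obtain \<xi> where "\<xi> \<in> S" and "norm (\<iota> (\<xi> - F \<xi>)) \<le> norm (\<iota> (u - u))"
    using F_dom by metis
  then have "\<iota> \<xi> = \<iota> (F \<xi>)" by (simp add: \<iota>.diff \<iota>.zero)
  then have fixed: "F \<xi> = \<xi>" using embed_XV(2) by (simp add: inj_eq)
  obtain Hs where "(\<lambda>m. \<iota> (iter_pol pol Hs \<xi> m)) \<longlonglongrightarrow> \<iota> (star \<xi>)"
    using iter_pol_tendsto \<open>\<xi> \<in> S\<close> by blast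
  then obtain m where "norm (\<iota> (iter_pol pol Hs \<xi> m) - \<iota> (star \<xi>)) < \<epsilon>"
    using LIMSEQ_D[OF _ eps(1)] by blast
  \<comment> \<open>\<open>\<Theta>\<close> is the identity on the iterates, which lie in
    \<open>S\<close>, and polarizing does not change the symmetrization. So closeness to
    \<open>star \<xi>\<close> is closeness of the iterate to its own symmetrization.\<close>
  moreover have "star (\<Theta> (iter_pol pol Hs \<xi> m)) = star \<xi>"
    using \<open>\<xi> \<in> S\<close> by (simp add: Theta_id iter_pol_in star_iter_pol)
  ultimately show ?thesis
    using fixed_point_iter_pol[OF \<open>\<xi> \<in> S\<close> fixed F_pol] by (metis \<iota>.diff)
qed

end
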